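(* There is a perfect set $P \subseteq \mathbb{R}^2$ which is contained in some $C^\infty$ arc and such that $P \cap A$ is countable for every non-squiggly set $A \subseteq \mathbb{R}^2$.
   Context: An arc in $\mathbb{R}^2$ is a set homeomorphic to a closed bounded interval $[a,b] \subset \mathbb{R}$ ($a<b$). A path is a homeomorphism $g$ mapping a compact interval onto an arc. For $k \ge 1$, an arc $A$ is $C^k$ iff $A$ is the image of some path $g$ which is a $C^k$ function and satisfies $g'(t) \ne 0$ for all $t$ in its domain (equivalently, $A$ has a $C^k$ arc length parameterization); $A$ is $C^\infty$ iff it is $C^k$ for all $k$. A perfect set is a nonempty closed set without isolated points. A set $A \subseteq \mathbb{R}^2$ is non-squiggly iff there is a $\delta$ with $0 < \delta \le \infty$ such that whenever $x,y,z,t$ are four distinct points of $A$ with $\mathrm{diam}(\{x,y,z,t\}) \le \delta$, the point $t$ is not interior to the triangle $xyz$. *)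

theory Defs
  imports "HOL-Analysis.Analysis"
begin

type_synonym plane = "real ^ 2"

definition perfect :: "plane set \<Rightarrow> bool" where
  "perfect P \<longleftrightarrow> P \<noteq> {} \<and> closed P \<and> \<not> (\<exists>x\<in>P. x isolated_in P)"

(* Derivatives are taken within S: for S = {a..b} they are one-sided at the
   endpoints. *)
primrec Ck_on :: "nat \<Rightarrow> (real \<Rightarrow> plane) \<Rightarrow> real set \<Rightarrow> bool" where
  "Ck_on 0 g S \<longleftrightarrow> continuous_on S g"
| "Ck_on (Suc k) g S \<longleftrightarrow>
     (\<exists>g'. (\<forall>t\<in>S. (g has_vector_derivative g' t) (at t within S)) \<and> Ck_on k g' S)"

(* The homeomorphism g from {a..b} with a < b already makes A an arc.  The
   definition is only meant for k at least 1. *)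
definition Ck_arc :: "nat \<Rightarrow> plane set \<Rightarrow> bool" where
  "Ck_arc k A \<longleftrightarrow>
     (\<exists>a b g h. a < b \<and> homeomorphism {a..b} A g h \<and> Ck_on k g {a..b} \<and>
        (\<forall>t\<in>{a..b}. vector_derivative g (at t within {a..b}) \<noteq> 0))"

(* The path may depend on k. *)
definition Cinf_arc :: "plane set \<Rightarrow> bool" where
  "Cinf_arc A \<longleftrightarrow> (\<forall>k\<ge>1. Ck_arc k A)"

(* A degenerate (collinear) triangle has empty interior, so it imposes no
   condition. *)
definition non_squiggly :: "plane set \<Rightarrow> bool" where
  "non_squiggly A \<longleftrightarrow>
     (\<exists>\<delta>::ereal. 0 < \<delta> \<and> \<delta> \<le> \<infinity> \<and>
        (\<forall>x\<in>A. \<forall>y\<in>A. \<forall>z\<in>A. \<forall>t\<in>A.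
           distinct [x, y, z, t] \<and> ereal (diameter {x, y, z, t}) \<le> \<delta> \<longrightarrow>
           t \<notin> interior (convex hull {x, y, z})))"

end

theory Submission
  imports Defs
begin

text \<open>
  The set \<open>P\<close> is the graph, over the ternary Cantor set \<open>C\<close>, of a smooth function \<open>f\<close> that is
  strictly increasing but has derivative \<open>0\<close> at every point of \<open>C\<close>.

  Let \<open>E \<subseteq> C\<close> be uncountable. Some \<open>c \<in> E\<close> is a limit of points of \<open>E\<close> from both sides
  (\<open>uncountable_two_sided_limit_point\<close>). Choose in \<open>E\<close>, as close to \<open>c\<close> as desired, first \<open>a < c\<close>,
  then \<open>d > c\<close>, then \<open>b\<close> with \<open>a < b < c\<close>. The chords from \<open>c\<close> to these points have positive slopes,
  because \<open>f\<close> is increasing, and the slopes tend to \<open>f' c = 0\<close>; so \<open>d\<close> and then \<open>b\<close> can be taken close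
  enough to \<open>c\<close> that slope \<open>ac\<close> \<open>>\<close> slope \<open>cd\<close> \<open>>\<close> slope \<open>bc\<close>. These two inequalities say that \<open>c\<close>
  lies above the chord \<open>ad\<close> and below the chord \<open>bd\<close>, and they put \<open>c\<close> inside the triangle \<open>abd\<close>
  (\<open>graph_point_in_triangle\<close>). Hence a set that meets \<open>P\<close> in uncountably many points contains
  forbidden quadruples of arbitrarily small diameter, and is not non-squiggly.

  It remains to find \<open>f\<close>. Its derivative has to be smooth, nonnegative, zero on \<open>C\<close>, and not
  identically zero on any interval. A point \<open>x\<close> of \<open>[0, 1]\<close> is in \<open>C\<close> exactly when
  \<open>sin (\<pi> 3\<^sup>n x) \<ge> 0\<close> for all \<open>n\<close>, since within the set left after stage \<open>n - 1\<close> of the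
  ternary construction the sine is negative just on the open gaps that stage \<open>n\<close> removes. So with \<open>\<psi> s = exp (- 1 / s)\<close> for \<open>s > 0\<close> and
  \<open>\<psi> s = 0\<close> otherwise, the function \<open>\<Sum>n. \<psi> (- sin (\<pi> 3\<^sup>n x)) / n!\<close> has zero set \<open>C\<close> in
  \<open>[0, 1]\<close>. It is smooth because the \<open>k\<close>-th derivative of the \<open>n\<close>-th term is at most
  a constant times \<open>3\<^sup>n\<^sup>k / n!\<close>, which is summable over \<open>n\<close> for each \<open>k\<close>.
\<close>

section \<open>Bounded smooth functions that vanish on prescribed intervals\<close>

text \<open>
  The derivatives of the standard flat function \<open>exp (- 1 / s)\<close> are combinations of these functions,
  so admitting the powers of \<open>1 / s\<close> gives a family closed under differentiation.
\<close>

definition flat :: "nat \<Rightarrow> real \<Rightarrow> real" where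
  "flat m s = (if 0 < s then inverse s ^ m * exp (- inverse s) else 0)"

lemma flat_nonneg: "0 \<le> flat m s"
  by (simp add: flat_def)

lemma flat_eq_0_iff: "flat m s = 0 \<longleftrightarrow> s \<le> 0"
  by (auto simp: flat_def)

lemma power_le_fact_mult_exp:
  fixes y :: real
  assumes "0 \<le> y"
  shows "y ^ m \<le> fact m * exp y"
proof -
  have "(\<Sum>n\<in>{m}. y ^ n /\<^sub>R fact n) \<le> (\<Sum>n. y ^ n /\<^sub>R fact n)"
    by (rule sum_le_suminf[OF summable_exp_generic]) (use assms in auto)
  then have "y ^ m / fact m \<le> exp y"
    by (simp add: exp_def divide_inverse mult.commute)
  then show ?thesis
    by (simp add: divide_le_eq mult.commute)
qed

lemma flat_le_fact: "flat m s \<le> fact m"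
proof (cases "0 < s")
  case True
  then have "inverse s ^ m * exp (- inverse s) \<le> fact m * exp (inverse s) * exp (- inverse s)"
    by (intro mult_right_mono power_le_fact_mult_exp) auto
  also have "\<dots> = fact m"
    by (simp flip: exp_add)
  finally show ?thesis
    using True by (simp add: flat_def)
qed (simp add: flat_def)

text \<open>
  Together with the uniform bound on \<open>flat (m + 2)\<close> this gives a quadratic bound on \<open>flat m\<close>
  at \<open>0\<close>, whence the derivative there vanishes.
\<close>

lemma flat_eq_square_mult: "flat m s = s\<^sup>2 * flat (m + 2) s"
  by (auto simp: flat_def field_simps power2_eq_square)

lemma flat_has_derivative:
  "(flat m has_real_derivative flat (m + 2) s - of_nat m * flat (m + 1) s) (at s)"
proof -
  consider "s < 0" | "s = 0" | "0 < s" by linarith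
  then show ?thesis
  proof cases
    case 1
    have "((\<lambda>_. 0) has_real_derivative 0) (at s)"
      by simp
    then have "(flat m has_real_derivative 0) (at s)"
      by (rule has_field_derivative_transform_within_open[where S = "{..<0}"])
        (use 1 in \<open>auto simp: flat_def\<close>)
    then show ?thesis
      using 1 by (simp add: flat_def)
  next
    case 2
    have "\<exists>d>0. \<forall>y. \<bar>y\<bar> < d \<longrightarrow> flat m y \<le> e * \<bar>y\<bar>" if "0 < e" for e
    proof (intro exI[of _ "e / fact (m + 2)"] conjI allI impI)
      show "0 < e / fact (m + 2)" using that by simp
    next
      fix y :: real
      assume "\<bar>y\<bar> < e / fact (m + 2)"
      then have "\<bar>y\<bar> * fact (m + 2) \<le> e"
        by (simp add: pos_less_divide_eq)
      have "flat m y \<le> \<bar>y\<bar> * (\<bar>y\<bar> * fact (m + 2))"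
        using mult_left_mono[OF flat_le_fact[of "m + 2" y], of "y\<^sup>2"]
        unfolding flat_eq_square_mult[of m y]
        by (simp add: power2_eq_square abs_mult_self_eq flip: mult.assoc)
      also have "\<dots> \<le> \<bar>y\<bar> * e"
        by (rule mult_left_mono[OF _ abs_ge_zero]) fact
      finally show "flat m y \<le> e * \<bar>y\<bar>"
        by (simp add: mult.commute)
    qed
    then have "(flat m has_derivative (\<lambda>h. 0)) (at 0)"
      unfolding has_derivative_at_alt using flat_nonneg
      by (auto simp: flat_def[of m 0])
    then show ?thesis
      using 2 by (simp add: has_field_derivative_def flat_def lambda_zero)
  next
    case 3
    have "((\<lambda>s. inverse s ^ m * exp (- inverse s)) has_real_derivative
        flat (m + 2) s - of_nat m * flat (m + 1) s) (at s)"
    proof (cases m)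
      case 0
      then show ?thesis
        using 3 by (auto intro!: derivative_eq_intros simp: flat_def power2_eq_square)
    next
      case (Suc j)
      show ?thesis
        unfolding Suc using 3
        by (auto intro!: derivative_eq_intros DERIV_power_Suc[THEN DERIV_cong]
            simp: flat_def algebra_simps power2_eq_square simp del: power_Suc)
          (simp add: algebra_simps power2_eq_square)
    qed
    then show ?thesis
      by (rule has_field_derivative_transform_within_open[where S = "{0<..}"])
        (use 3 in \<open>auto simp: flat_def\<close>)
  qed
qed

text \<open>
  Each generator is bounded and has its derivative in the algebra, and both properties pass to sums
  and products. Thus every member has derivatives of all orders, each of them bounded on the whole
  line, without any formula for these derivatives.
\<close>

inductive_set bump_algebra :: "(real \<Rightarrow> real) set" where
  const: "(\<lambda>x. c) \<in> bump_algebra"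
| sin: "(\<lambda>x. sin (pi * x)) \<in> bump_algebra"
| cos: "(\<lambda>x. cos (pi * x)) \<in> bump_algebra"
| flat: "(\<lambda>x. flat m (- sin (pi * x))) \<in> bump_algebra"
| add: "f \<in> bump_algebra \<Longrightarrow> g \<in> bump_algebra \<Longrightarrow> (\<lambda>x. f x + g x) \<in> bump_algebra"
| mult: "f \<in> bump_algebra \<Longrightarrow> g \<in> bump_algebra \<Longrightarrow> (\<lambda>x. f x * g x) \<in> bump_algebra"

lemma bump_algebra_bounded:
  "f \<in> bump_algebra \<Longrightarrow> \<exists>B. \<forall>x. \<bar>f x\<bar> \<le> B"
proof (induction rule: bump_algebra.induct)
  case (flat m)
  show ?case
    by (rule exI[of _ "fact m"]) (simp add: flat_nonneg flat_le_fact)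
next
  case (add f g)
  then obtain B C where "\<And>x. \<bar>f x\<bar> \<le> B" "\<And>x. \<bar>g x\<bar> \<le> C"
    by blast
  then have "\<bar>f x + g x\<bar> \<le> B + C" for x
    by (meson abs_triangle_ineq add_mono order_trans)
  then show ?case
    by blast
next
  case (mult f g)
  then obtain B C where "\<And>x. \<bar>f x\<bar> \<le> B" "\<And>x. \<bar>g x\<bar> \<le> C"
    by blast
  then have "\<bar>f x * g x\<bar> \<le> B * C" for x
    unfolding abs_mult by (intro mult_mono) (auto intro: order_trans[OF abs_ge_zero])
  then show ?case
    by blast
qed (auto intro: abs_sin_le_one abs_cos_le_one)

lemma bump_algebra_derivative:
  "f \<in> bump_algebra \<Longrightarrow> \<exists>f'\<in>bump_algebra. \<forall>x. (f has_real_derivative f' x) (at x)"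
proof (induction rule: bump_algebra.induct)
  case (const c)
  show ?case
    by (rule bexI[OF _ bump_algebra.const[of 0]]) simp
next
  case sin
  show ?case
    by (rule bexI[OF _ bump_algebra.mult[OF bump_algebra.const[of pi] bump_algebra.cos]])
      (auto intro!: derivative_eq_intros)
next
  case cos
  show ?case
    by (rule bexI[OF _ bump_algebra.mult[OF bump_algebra.const[of "- pi"] bump_algebra.sin]])
      (auto intro!: derivative_eq_intros)
next
  case (flat m)
  let ?f' = "\<lambda>x. (flat (m + 2) (- sin (pi * x)) + (- of_nat m) * flat (m + 1) (- sin (pi * x)))
               * ((- pi) * cos (pi * x))"
  show ?case
  proof (rule bexI[of _ ?f'])
    show "?f' \<in> bump_algebra"
      by (intro bump_algebra.intros)
    show "\<forall>x. ((\<lambda>x. flat m (- sin (pi * x))) has_real_derivative ?f' x) (at x)"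
      by (intro allI DERIV_chain'[OF _ flat_has_derivative, THEN DERIV_cong])
        (auto intro!: derivative_eq_intros)
  qed
next
  case (add f g)
  then obtain f' g' where "f' \<in> bump_algebra" "g' \<in> bump_algebra"
    "\<And>x. (f has_real_derivative f' x) (at x)" "\<And>x. (g has_real_derivative g' x) (at x)"
    by blast
  then show ?case
    by (intro bexI[OF _ bump_algebra.add[of f' g']]) (auto intro!: derivative_eq_intros)
next
  case (mult f g)
  then obtain f' g' where "f' \<in> bump_algebra" "g' \<in> bump_algebra"
    "\<And>x. (f has_real_derivative f' x) (at x)" "\<And>x. (g has_real_derivative g' x) (at x)"
    by blast
  with mult.hyps show ?case
    by (intro bexI[of _ "\<lambda>x. f x * g' x + f' x * g x"] bump_algebra.intros)
      (auto intro!: derivative_eq_intros)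
qed

section \<open>A smooth function whose zero set is the Cantor set\<close>

text \<open>
  The \<open>k\<close>-th termwise derivative of \<open>\<Sum>n. f (3\<^sup>n x) / n!\<close> is this series with \<open>f\<close> replaced by
  its \<open>k\<close>-th derivative.
\<close>

definition lacunary_series :: "(real \<Rightarrow> real) \<Rightarrow> nat \<Rightarrow> real \<Rightarrow> real" where
  "lacunary_series f k x = (\<Sum>n. (3 ^ k) ^ n / fact n * f (3 ^ n * x))"

text \<open>
  This is the exponential series at \<open>3\<^sup>k\<close>.
\<close>

lemma summable_lacunary_coefficients: "summable (\<lambda>n. (3 ^ k) ^ n / fact n * B :: real)"
  using summable_mult2[OF summable_exp_generic[of "3 ^ k :: real"], of B]
  by (simp add: divide_inverse mult.commute)

lemma summable_lacunary_series:
  fixes f :: "real \<Rightarrow> real"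
  assumes "\<And>x. \<bar>f x\<bar> \<le> B"
  shows "summable (\<lambda>n. (3 ^ k) ^ n / fact n * f (3 ^ n * x))"
  by (rule summable_comparison_test'[OF summable_lacunary_coefficients[of k B]])
    (auto simp: abs_mult intro!: divide_right_mono mult_left_mono assms)

lemma lacunary_series_has_derivative:
  assumes f: "\<And>x. \<bar>f x\<bar> \<le> B" and f': "\<And>x. \<bar>f' x\<bar> \<le> B'"
    and deriv: "\<And>x. (f has_real_derivative f' x) (at x)"
  shows "(lacunary_series f k has_real_derivative lacunary_series f' (Suc k) x) (at x)"
  unfolding lacunary_series_def
proof (rule has_field_derivative_series'(2)[where S = UNIV and ?x0.0 = 0])
  show "((\<lambda>x. (3 ^ k) ^ n / fact n * f (3 ^ n * x)) has_real_derivative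
          (3 ^ Suc k) ^ n / fact n * f' (3 ^ n * x)) (at x)" for n x
    by (auto intro!: derivative_eq_intros DERIV_chain'[OF _ deriv] simp: power_mult_distrib)
  show "uniformly_convergent_on UNIV
          (\<lambda>n x. \<Sum>i<n. (3 ^ Suc k) ^ i / fact i * f' (3 ^ i * x))"
    by (rule Weierstrass_m_test'[OF _ summable_lacunary_coefficients[of "Suc k" B']])
      (auto simp: abs_mult intro!: divide_right_mono mult_left_mono f')
  show "summable (\<lambda>n. (3 ^ k) ^ n / fact n * f (3 ^ n * 0))"
    by (rule summable_lacunary_series) (rule f)
qed auto

definition cantor_height :: "real \<Rightarrow> real" where
  "cantor_height = lacunary_series (\<lambda>x. flat 0 (- sin (pi * x))) 0"

text \<open>
  Multiplication by \<open>3\<^sup>n\<close> carries the intervals left after stage \<open>n\<close> of the ternary construction to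
  intervals \<open>[2m, 2m + 1]\<close>, on which \<open>sin (\<pi> z)\<close> is nonnegative. In this form the set is
  visibly closed, and visibly the zero set in \<open>[0, 1]\<close> of the function above.
\<close>

definition cantor_set :: "real set" where
  "cantor_set = {x \<in> {0..1}. \<forall>n. 0 \<le> sin (pi * (3 ^ n * x))}"

lemma summable_cantor_height:
  "summable (\<lambda>n. (3 ^ 0) ^ n / fact n * flat 0 (- sin (pi * (3 ^ n * x))))"
proof -
  obtain B where "\<And>x. \<bar>flat 0 (- sin (pi * x))\<bar> \<le> B"
    using bump_algebra_bounded[OF bump_algebra.flat] by blast
  then show ?thesis
    by (rule summable_lacunary_series)
qed

lemma cantor_height_nonneg: "0 \<le> cantor_height x"
  unfolding cantor_height_def lacunary_series_def
  by (intro suminf_nonneg summable_cantor_height mult_nonneg_nonneg) (auto simp: flat_nonneg)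

lemma cantor_height_eq_0_iff:
  "cantor_height x = 0 \<longleftrightarrow> (\<forall>n. 0 \<le> sin (pi * (3 ^ n * x)))"
  unfolding cantor_height_def lacunary_series_def
  by (subst suminf_eq_zero_iff[OF summable_cantor_height])
    (auto simp: flat_nonneg flat_eq_0_iff)

lemma cantor_height_derivatives:
  obtains r where "r 0 = cantor_height"
    "\<And>k x. (r k has_real_derivative r (Suc k) x) (at x)"
proof -
  let ?Q = "\<lambda>f f'. \<forall>x. (f has_real_derivative f' x) (at x)"
  have "\<exists>\<phi>. \<forall>n. (\<phi> n \<in> bump_algebra \<and> (n = 0 \<longrightarrow> \<phi> n = (\<lambda>x. flat 0 (- sin (pi * x)))))
      \<and> ?Q (\<phi> n) (\<phi> (Suc n))"
  proof (rule dependent_nat_choice)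
    show "\<exists>f. f \<in> bump_algebra \<and> ((0::nat) = 0 \<longrightarrow> f = (\<lambda>x. flat 0 (- sin (pi * x))))"
      using bump_algebra.flat by blast
  qed (use bump_algebra_derivative in fastforce)
  then obtain \<phi> where \<phi>: "\<And>n. \<phi> n \<in> bump_algebra" "\<phi> 0 = (\<lambda>x. flat 0 (- sin (pi * x)))"
    "\<And>n x. (\<phi> n has_real_derivative \<phi> (Suc n) x) (at x)"
    by blast
  show ?thesis
  proof
    show "lacunary_series (\<phi> 0) 0 = cantor_height"
      by (simp add: cantor_height_def \<phi>(2))
    show "(lacunary_series (\<phi> k) k has_real_derivative lacunary_series (\<phi> (Suc k)) (Suc k) x) (at x)"
      for k x
      using bump_algebra_bounded[OF \<phi>(1)[of k]] bump_algebra_bounded[OF \<phi>(1)[of "Suc k"]] \<phi>(3)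
        lacunary_series_has_derivative by metis
  qed
qed

section \<open>Perfectness and nowhere density of the Cantor set\<close>

lemma sin_pi_nonneg_iff:
  "0 \<le> sin (pi * z) \<longleftrightarrow> (\<exists>m::int. 2 * of_int m \<le> z \<and> z \<le> 2 * of_int m + 1)"
proof -
  have shift: "sin (pi * z) = sin (pi * (z - 2 * of_int m))" for m :: int
    using sin_int_2pin[of m] cos_int_2pin[of m]
    by (simp add: right_diff_distrib sin_diff mult.assoc mult.left_commute)
  show ?thesis
  proof
    assume nonneg: "0 \<le> sin (pi * z)"
    define m where "m = \<lfloor>z / 2\<rfloor>"
    have m: "2 * of_int m \<le> z" "z < 2 * of_int m + 2"
      unfolding m_def by linarith+
    have "z \<le> 2 * of_int m + 1"
    proof (rule ccontr)
      assume "\<not> z \<le> 2 * of_int m + 1"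
      then have "pi * 1 < pi * (z - 2 * of_int m)" "pi * (z - 2 * of_int m) < pi * 2"
        using m by (intro mult_strict_left_mono; simp)+
      then have "sin (pi * (z - 2 * of_int m)) < 0"
        by (intro sin_lt_zero) auto
      then show False
        using nonneg shift[of m] by simp
    qed
    then show "\<exists>m::int. 2 * of_int m \<le> z \<and> z \<le> 2 * of_int m + 1"
      using m by blast
  next
    assume "\<exists>m::int. 2 * of_int m \<le> z \<and> z \<le> 2 * of_int m + 1"
    then obtain m :: int where m: "2 * of_int m \<le> z" "z \<le> 2 * of_int m + 1"
      by blast
    then have "0 \<le> pi * (z - 2 * of_int m)" "pi * (z - 2 * of_int m) \<le> pi * 1"
      by (simp, intro mult_left_mono) auto
    then show "0 \<le> sin (pi * z)"
      unfolding shift[of m] by (intro sin_ge_zero) auto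
  qed
qed

text \<open>
  Parity is what keeps both endpoints of a stage interval inside the larger stage intervals that
  contain one of its points: an integer interval with even left and odd right end that meets
  \<open>[2M, 2M + 1]\<close> contains it.
\<close>

lemma even_le_odd_bounds:
  fixes M Z :: int
  shows "Z \<le> 2 * M + 1 \<Longrightarrow> even Z \<Longrightarrow> Z \<le> 2 * M" "2 * M \<le> Z \<Longrightarrow> odd Z \<Longrightarrow> 2 * M + 1 \<le> Z"
  by presburger+

lemma closed_cantor_set: "closed cantor_set"
proof -
  have eq: "cantor_set = {0..1} \<inter> (\<Inter>n. {x. 0 \<le> sin (pi * (3 ^ n * x))})"
    by (auto simp: cantor_set_def)
  show ?thesis
    unfolding eq
    by (intro closed_Int closed_INT ballI closed_Collect_le continuous_intros closed_atLeastAtMost)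
qed

lemma zero_in_cantor_set: "0 \<in> cantor_set"
  by (simp add: cantor_set_def)

text \<open>
  Given \<open>x\<close> in the interval \<open>[2M / 3\<^sup>k, (2M + 1) / 3\<^sup>k]\<close> of stage \<open>k\<close>, both endpoints of that interval
  belong to the Cantor set, they are within \<open>3\<^sup>-\<^sup>k\<close> of \<open>x\<close>, and at most one of them is \<open>x\<close>. At
  stages up to \<open>k\<close> an endpoint is in the same interval as \<open>x\<close>; at later stages the sine at it vanishes.
\<close>

lemma cantor_set_not_isolated:
  assumes x: "x \<in> cantor_set" and "0 < e"
  shows "\<exists>y\<in>cantor_set. y \<noteq> x \<and> \<bar>y - x\<bar> < e"
proof -
  obtain k where k: "(1/3::real) ^ k < e"
    using real_arch_pow_inv[OF \<open>0 < e\<close>, of "1/3"] by auto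
  obtain M :: int where M: "2 * of_int M \<le> 3 ^ k * x" "3 ^ k * x \<le> 2 * of_int M + 1"
    using x sin_pi_nonneg_iff[of "3 ^ k * x"] by (auto simp: cantor_set_def)
  have endpoint: "y \<in> cantor_set"
    if N: "3 ^ k * y = of_int N" "N = 2 * M \<or> N = 2 * M + 1" for y :: real and N :: int
  proof -
    have trapped: "2 * of_int m \<le> 3 ^ j * y \<and> 3 ^ j * y \<le> 2 * of_int m + 1"
      if "j \<le> k" and m: "2 * of_int m \<le> 3 ^ j * x" "3 ^ j * x \<le> 2 * of_int m + 1"
      for j and m :: int
    proof -
      define p :: int where "p = 3 ^ (k - j)"
      have p: "of_int p * 3 ^ j = (3 ^ k :: real)" "0 < p" "odd p"
        using \<open>j \<le> k\<close> by (auto simp: p_def simp flip: power_add)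
      have "of_int p * (2 * of_int m) \<le> of_int p * (3 ^ j * x)"
        "of_int p * (3 ^ j * x) \<le> of_int p * (2 * of_int m + 1)"
        using m p(2) by (intro mult_left_mono; simp)+
      then have "of_int (p * (2 * m)) \<le> 3 ^ k * x" "3 ^ k * x \<le> of_int (p * (2 * m + 1))"
        unfolding mult.assoc[symmetric] p(1) by (simp_all add: mult.assoc)
      with M have "of_int (p * (2 * m)) \<le> (of_int (2 * M + 1) :: real)"
        "(of_int (2 * M) :: real) \<le> of_int (p * (2 * m + 1))"
        by simp_all
      then have "p * (2 * m) \<le> 2 * M + 1" "2 * M \<le> p * (2 * m + 1)"
        by (simp_all only: of_int_le_iff)
      moreover have "even (p * (2 * m))" "odd (p * (2 * m + 1))"
        using p(3) by auto
      ultimately have "p * (2 * m) \<le> 2 * M" "2 * M + 1 \<le> p * (2 * m + 1)"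
        using even_le_odd_bounds by blast+
      then have "p * (2 * m) \<le> N" "N \<le> p * (2 * m + 1)"
        using N(2) by auto
      then have "of_int (p * (2 * m)) \<le> (of_int N :: real)" "of_int N \<le> (of_int (p * (2 * m + 1)) :: real)"
        by (simp_all only: of_int_le_iff)
      then have "of_int p * (2 * of_int m) \<le> of_int p * (3 ^ j * y)"
        "of_int p * (3 ^ j * y) \<le> of_int p * (2 * of_int m + 1)"
        unfolding mult.assoc[symmetric] p(1) N(1) by (simp_all add: mult.assoc)
      then show ?thesis
        using p(2) by (simp add: mult_le_cancel_left)
    qed
    \<comment> \<open>Stage \<open>0\<close> with \<open>m = 0\<close> is the interval \<open>[0, 1]\<close> itself.\<close>
    have "0 \<le> y \<and> y \<le> 1"
      using trapped[of 0 0] x by (simp add: cantor_set_def)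
    moreover have "0 \<le> sin (pi * (3 ^ n * y))" for n
    proof (cases "n \<le> k")
      case True
      obtain m :: int where "2 * of_int m \<le> 3 ^ n * x" "3 ^ n * x \<le> 2 * of_int m + 1"
        using x sin_pi_nonneg_iff[of "3 ^ n * x"] by (auto simp: cantor_set_def)
      then show ?thesis
        using trapped[OF True] sin_pi_nonneg_iff by blast
    next
      case False
      have "3 ^ n * y = 3 ^ (n - k) * (3 ^ k * y)"
        using False by (simp flip: power_add mult.assoc)
      also have "\<dots> = of_int (3 ^ (n - k) * N)"
        by (simp add: N(1))
      finally show ?thesis
        by (simp only: sin_npi_int order_refl)
    qed
    ultimately show ?thesis
      by (simp add: cantor_set_def)
  qed
  obtain N :: int where N: "N = 2 * M \<or> N = 2 * M + 1" "of_int N \<noteq> 3 ^ k * x"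
    by (cases "of_int (2 * M) = 3 ^ k * x") (auto simp: that[of "2 * M"] intro: that[of "2 * M + 1"])
  define y where "y = of_int N / (3 ^ k :: real)"
  have y: "3 ^ k * y = of_int N"
    by (simp add: y_def)
  have "\<bar>3 ^ k * y - 3 ^ k * x\<bar> \<le> 1"
    using M N(1) unfolding y by auto
  then have "3 ^ k * \<bar>y - x\<bar> \<le> 1"
    by (simp add: abs_mult flip: right_diff_distrib)
  then have "\<bar>y - x\<bar> \<le> (1/3) ^ k"
    by (simp add: field_simps)
  moreover have "y \<noteq> x"
    using N(2) y by auto
  ultimately show ?thesis
    using endpoint[OF y N(1)] k by force
qed

text \<open>
  At a fine enough scale \<open>3\<^sup>n\<close> the interval contains a midpoint \<open>2m + 3/2\<close> of a gap, where the sine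
  is negative.
\<close>

lemma cantor_height_pos_between:
  assumes "x < y"
  shows "\<exists>t. x < t \<and> t < y \<and> 0 < cantor_height t"
proof -
  obtain n where n: "3 / (y - x) < 3 ^ n"
    using real_arch_pow[of 3 "3 / (y - x)"] by auto
  then have gap: "3 ^ n * x + 3 < 3 ^ n * y"
    using assms by (simp add: field_simps)
  define m where "m = \<lceil>(3 ^ n * x - 1) / 2\<rceil>"
  define z where "z = 2 * of_int m + (3/2 :: real)"
  have m: "3 ^ n * x - 1 \<le> 2 * of_int m" "2 * of_int m < 3 ^ n * x + 1"
    using ceiling_correct[of "(3 ^ n * x - 1) / 2"] unfolding m_def[symmetric] by (simp_all add: field_simps)
  have "\<not> (2 * of_int i \<le> z \<and> z \<le> 2 * of_int i + 1)" for i :: int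
  proof
    assume "2 * of_int i \<le> z \<and> z \<le> 2 * of_int i + 1"
    then have "of_int i < (of_int (m + 1) :: real)" "(of_int m :: real) < of_int i"
      by (auto simp: z_def)
    then show False
      by simp
  qed
  then have "\<not> 0 \<le> sin (pi * z)"
    unfolding sin_pi_nonneg_iff by blast
  then have neg: "\<not> 0 \<le> sin (pi * (3 ^ n * (z / 3 ^ n)))"
    by simp
  then have "cantor_height (z / 3 ^ n) \<noteq> 0"
    unfolding cantor_height_eq_0_iff by blast
  then have "0 < cantor_height (z / 3 ^ n)"
    using cantor_height_nonneg[of "z / 3 ^ n"] by simp
  moreover have "x < z / 3 ^ n"
    using m by (simp add: z_def field_simps)
  moreover have "z / 3 ^ n < y" if "2 * of_int m + 3/2 < 3 ^ n * y"
    using that by (simp add: z_def field_simps)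
  moreover have "2 * of_int m + 3/2 < 3 ^ n * y"
    using m gap by simp
  ultimately show ?thesis
    by blast
qed

section \<open>Four points on a graph with one inside the triangle of the others\<close>

definition pt :: "real \<Rightarrow> real \<Rightarrow> plane" where
  "pt x y = x *\<^sub>R axis 1 1 + y *\<^sub>R axis 2 1"

lemma pt_nth [simp]: "pt x y $ 1 = x" "pt x y $ 2 = y"
  by (simp_all add: pt_def axis_def)

lemma pt_add: "pt x y + pt x' y' = pt (x + x') (y + y')"
  and pt_scaleR: "c *\<^sub>R pt x y = pt (c * x) (c * y)"
  by (simp_all add: vec_eq_iff forall_2)

lemma pt_eq_iff [simp]: "pt x y = pt x' y' \<longleftrightarrow> x = x' \<and> y = y'"
  by (auto simp: vec_eq_iff forall_2)

text \<open>
  With the fourth point \<open>(u, v)\<close> as origin, the vertices are \<open>- p (1, s1)\<close>, \<open>- q (1, s3)\<close> and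
  \<open>r (1, s2)\<close>. The weights \<open>(s2 - s3) / p\<close>, \<open>(s1 - s2) / q\<close> and \<open>(s1 - s3) / r\<close> combine them to
  \<open>0\<close>; they are positive exactly by the ordering of the slopes, and after division by their sum
  they are the barycentric coordinates.
\<close>

lemma middle_point_in_triangle:
  fixes p q r s1 s2 s3 :: real
  assumes pos: "0 < p" "0 < q" "0 < r" and slopes: "s2 < s1" "s3 < s2"
  shows "pt u v \<in> interior (convex hull
    {pt (u - p) (v - p * s1), pt (u - q) (v - q * s3), pt (u + r) (v + r * s2)})"
    (is "_ \<in> interior (convex hull {?A, ?B, ?D})")
proof -
  have "\<not> collinear {?A, ?B, ?D}"
  proof
    assume "collinear {?A, ?B, ?D}"
    then obtain w where w: "\<And>X Y. X \<in> {?A, ?B, ?D} \<Longrightarrow> Y \<in> {?A, ?B, ?D} \<Longrightarrow> \<exists>c. X - Y = c *\<^sub>R w"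
      unfolding collinear_def by blast
    obtain c where "?D - ?A = c *\<^sub>R w"
      using w[of ?D ?A] by blast
    then have c: "p + r = c * w $ 1" "p * s1 + r * s2 = c * w $ 2"
      by (auto simp: vec_eq_iff forall_2)
    obtain c' where "?D - ?B = c' *\<^sub>R w"
      using w[of ?D ?B] by blast
    then have c': "q + r = c' * w $ 1" "q * s3 + r * s2 = c' * w $ 2"
      by (auto simp: vec_eq_iff forall_2)
    \<comment> \<open>Two edge vectors along a common line have determinant \<open>0\<close>, but this one is negative.\<close>
    have "(p + r) * (q * s3 + r * s2) - (p * s1 + r * s2) * (q + r) = 0"
      unfolding c c' by (simp add: algebra_simps)
    moreover have "(p + r) * (q * s3 + r * s2) - (p * s1 + r * s2) * (q + r)
        = - (p * q * (s1 - s3) + p * r * (s1 - s2) + q * r * (s2 - s3))"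
      by (simp add: algebra_simps)
    moreover have "0 < p * q * (s1 - s3)" "0 < p * r * (s1 - s2)" "0 < q * r * (s2 - s3)"
      using assms by simp_all
    ultimately show False
      by linarith
  qed
  then have int: "interior (convex hull {?A, ?B, ?D})
      = {v. \<exists>x y z. 0 < x \<and> 0 < y \<and> 0 < z \<and> x + y + z = 1 \<and> x *\<^sub>R ?A + y *\<^sub>R ?B + z *\<^sub>R ?D = v}"
    by (rule interior_convex_hull_3_minimal) simp
  define \<alpha> \<beta> \<gamma> where "\<alpha> = (s2 - s3) / p" and "\<beta> = (s1 - s2) / q" and "\<gamma> = (s1 - s3) / r"
  define S where "S = \<alpha> + \<beta> + \<gamma>"
  have pos': "0 < \<alpha>" "0 < \<beta>" "0 < \<gamma>"
    using assms by (simp_all add: \<alpha>_def \<beta>_def \<gamma>_def)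
  then have "0 < S"
    by (simp add: S_def)
  have eqs: "\<alpha> * p = s2 - s3" "\<beta> * q = s1 - s2" "\<gamma> * r = s1 - s3"
    using pos by (simp_all add: \<alpha>_def \<beta>_def \<gamma>_def)
  have first: "\<alpha> * (u - p) + \<beta> * (u - q) + \<gamma> * (u + r) = S * u"
    using eqs by (simp add: S_def algebra_simps)
  have "\<alpha> * (v - p * s1) + \<beta> * (v - q * s3) + \<gamma> * (v + r * s2)
      = S * v - (\<alpha> * p) * s1 - (\<beta> * q) * s3 + (\<gamma> * r) * s2"
    by (simp add: S_def algebra_simps)
  also have "\<dots> = S * v"
    unfolding eqs by (simp add: algebra_simps)
  finally have second: "\<alpha> * (v - p * s1) + \<beta> * (v - q * s3) + \<gamma> * (v + r * s2) = S * v" .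
  have "(\<alpha> / S) *\<^sub>R ?A + (\<beta> / S) *\<^sub>R ?B + (\<gamma> / S) *\<^sub>R ?D = pt u v"
    using \<open>0 < S\<close> first second
    by (simp add: pt_scaleR pt_add flip: add_divide_distrib)
  moreover have "\<alpha> / S + \<beta> / S + \<gamma> / S = 1"
    using \<open>0 < S\<close> by (simp add: S_def flip: add_divide_distrib)
  ultimately show ?thesis
    unfolding int using pos' \<open>0 < S\<close> by (intro CollectI exI conjI) auto
qed

lemma graph_point_in_triangle:
  fixes f :: "real \<Rightarrow> real"
  assumes order: "a < c" "b < c" "c < d"
    and "(f d - f c) / (d - c) < (f c - f a) / (c - a)"
    and "(f c - f b) / (c - b) < (f d - f c) / (d - c)"
  shows "pt c (f c) \<in> interior (convex hull {pt a (f a), pt b (f b), pt d (f d)})"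
  using middle_point_in_triangle[of "c - a" "c - b" "d - c", OF _ _ _ assms(4,5), of c "f c"] order
  by simp

section \<open>Two-sided limit points of uncountable sets of reals\<close>

text \<open>
  A rational chosen in the gap after each point determines the point.
\<close>

lemma countable_right_gap_points:
  fixes G :: "real set"
  assumes gap: "\<And>c. c \<in> G \<Longrightarrow> \<exists>e>0. \<forall>x\<in>G. x \<le> c \<or> c + e \<le> x"
  shows "countable G"
proof -
  have "\<exists>q::rat. c < of_rat q \<and> (\<forall>x\<in>G. x \<le> c \<or> of_rat q < x)" if c: "c \<in> G" for c
  proof -
    obtain e where "0 < e" and e: "\<forall>x\<in>G. x \<le> c \<or> c + e \<le> x"
      using gap[OF c] by (elim exE conjE)
    obtain q where q: "c < of_rat q" "of_rat q < c + e"
      using of_rat_dense[of c "c + e"] \<open>0 < e\<close> by auto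
    have "x \<le> c \<or> of_rat q < x" if "x \<in> G" for x
      using bspec[OF e that] q(2) by linarith
    with q(1) show ?thesis
      by (intro exI[of _ q] conjI ballI)
  qed
  then obtain q :: "real \<Rightarrow> rat" where
    q: "\<And>c. c \<in> G \<Longrightarrow> c < of_rat (q c)" "\<And>c x. c \<in> G \<Longrightarrow> x \<in> G \<Longrightarrow> x \<le> c \<or> of_rat (q c) < x"
    by metis
  have le: "x \<le> c" if "c \<in> G" "x \<in> G" "q c = q x" for c x
    using q(2)[OF that(1,2)] q(1)[OF that(2)] that(3) by auto
  have "inj_on q G"
    by (rule inj_onI, rule antisym) (auto intro: le)
  then show ?thesis
    by (rule countableI')
qed

lemma countable_left_gap_points:
  fixes G :: "real set"
  assumes gap: "\<And>c. c \<in> G \<Longrightarrow> \<exists>e>0. \<forall>x\<in>G. c \<le> x \<or> x \<le> c - e"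
  shows "countable G"
proof -
  have "countable (uminus ` G)"
  proof (rule countable_right_gap_points)
    fix c
    assume "c \<in> uminus ` G"
    then have "- c \<in> G"
      by auto
    from gap[OF this] obtain e where "0 < e" and e: "\<forall>x\<in>G. - c \<le> x \<or> x \<le> - c - e"
      by (elim exE conjE)
    have "y \<le> c \<or> c + e \<le> y" if "y \<in> uminus ` G" for y
    proof -
      have "- y \<in> G"
        using that by auto
      then show ?thesis
        using bspec[OF e, of "- y"] by linarith
    qed
    with \<open>0 < e\<close> show "\<exists>e>0. \<forall>y\<in>uminus ` G. y \<le> c \<or> c + e \<le> y"
      by (intro exI[of _ e] conjI ballI)
  qed
  then show ?thesis
    by (rule countable_image_inj_on) simp
qed

lemma uncountable_two_sided_limit_point:
  fixes E :: "real set"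
  assumes "uncountable E"
  obtains c where "c \<in> E" "\<And>e. 0 < e \<Longrightarrow> \<exists>x\<in>E. c < x \<and> x < c + e"
    "\<And>e. 0 < e \<Longrightarrow> \<exists>x\<in>E. c - e < x \<and> x < c"
proof -
  define right_gap left_gap
    where "right_gap c \<longleftrightarrow> (\<exists>e>0. \<forall>x\<in>E. x \<le> c \<or> c + e \<le> x)"
      and "left_gap c \<longleftrightarrow> (\<exists>e>0. \<forall>x\<in>E. c \<le> x \<or> x \<le> c - e)" for c
  have "countable {c \<in> E. right_gap c}"
    by (rule countable_right_gap_points) (force simp: right_gap_def)
  moreover have "countable {c \<in> E. left_gap c}"
    by (rule countable_left_gap_points) (force simp: left_gap_def)
  ultimately have "countable ({c \<in> E. right_gap c} \<union> {c \<in> E. left_gap c})"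
    by (rule countable_Un)
  then have "\<not> E \<subseteq> {c \<in> E. right_gap c} \<union> {c \<in> E. left_gap c}"
    using assms by (metis countable_subset)
  then obtain c where c: "c \<in> E" "\<not> right_gap c" "\<not> left_gap c"
    by blast
  show ?thesis
  proof (rule that[OF c(1)])
    show "\<exists>x\<in>E. c < x \<and> x < c + e" if "0 < e" for e
      using c(2) that by (auto simp: right_gap_def not_le)
    show "\<exists>x\<in>E. c - e < x \<and> x < c" if "0 < e" for e
      using c(3) that by (auto simp: left_gap_def not_le)
  qed
qed

section \<open>The curve\<close>

lemma Ck_on_of_derivative_sequence:
  assumes "\<And>k t. t \<in> S \<Longrightarrow> (r k has_vector_derivative r (Suc k) t) (at t within S)"
  shows "Ck_on n (r k) S"
proof (induction n arbitrary: k)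
  case 0
  show ?case
    unfolding Ck_on.simps by (rule continuous_on_vector_derivative) (rule assms)
next
  case (Suc n)
  show ?case
    unfolding Ck_on.simps by (intro exI[of _ "r (Suc k)"] conjI ballI assms Suc.IH)
qed

lemma pt_has_vector_derivative:
  assumes "(u has_real_derivative u') (at t within S)" "(v has_real_derivative v') (at t within S)"
  shows "((\<lambda>t. pt (u t) (v t)) has_vector_derivative pt u' v') (at t within S)"
  unfolding pt_def using assms
  by (auto intro!: derivative_eq_intros)

text \<open>
  The parameterization by the first coordinate has speed at least \<open>1\<close>, and the first projection is
  its inverse; \<open>r k\<close> is the \<open>k\<close>-th derivative of the function whose graph is taken.
\<close>

lemma Cinf_arc_graph:
  fixes r :: "nat \<Rightarrow> real \<Rightarrow> real"
  assumes r: "\<And>k t. t \<in> {0..1} \<Longrightarrow> (r k has_real_derivative r (Suc k) t) (at t within {0..1})"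
  shows "Cinf_arc ((\<lambda>t. pt t (r 0 t)) ` {0..1})"
proof -
  \<comment> \<open>The successive derivatives of the first coordinate.\<close>
  define u :: "nat \<Rightarrow> real \<Rightarrow> real"
    where "u k t = (if k = 0 then t else if k = 1 then 1 else 0)" for k t
  define \<gamma> where "\<gamma> k t = pt (u k t) (r k t)" for k t
  have u: "(u k has_real_derivative u (Suc k) t) (at t within {0..1})" for k t
  proof (cases "k = 0")
    case True
    then have "u k = (\<lambda>t. t)"
      by (simp add: u_def fun_eq_iff)
    then show ?thesis
      using True by (simp add: u_def)
  next
    case False
    then have "u k = (\<lambda>_. u k 0)"
      by (simp add: u_def fun_eq_iff)
    then have "(u k has_real_derivative 0) (at t within {0..1})"
      by (metis DERIV_const)
    then show ?thesis
      using False by (simp add: u_def)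
  qed
  have \<gamma>: "(\<gamma> k has_vector_derivative \<gamma> (Suc k) t) (at t within {0..1})" if "t \<in> {0..1}" for k t
    using pt_has_vector_derivative[OF u r[OF that]] by (simp add: \<gamma>_def[abs_def])
  have \<gamma>0: "\<gamma> 0 = (\<lambda>t. pt t (r 0 t))"
    by (simp add: \<gamma>_def u_def fun_eq_iff)
  have "continuous_on {0..1} (\<gamma> 0)"
    by (rule continuous_on_vector_derivative) (rule \<gamma>)
  then have "homeomorphism {0..1} (\<gamma> 0 ` {0..1}) (\<gamma> 0) (\<lambda>v. v $ 1)"
    by (auto simp: homeomorphism_def \<gamma>0 image_image intro!: continuous_intros)
  moreover have "Ck_on k (\<gamma> 0) {0..1}" for k
    by (rule Ck_on_of_derivative_sequence) (rule \<gamma>)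
  moreover have "vector_derivative (\<gamma> 0) (at t within {0..1}) \<noteq> 0" if "t \<in> {0..1}" for t
  proof -
    have "vector_derivative (\<gamma> 0) (at t within {0..1}) = \<gamma> 1 t"
      using vector_derivative_within_cbox[of 0 1 t "\<gamma> 0"] \<gamma>[OF that, of 0] that by simp
    moreover have "\<gamma> 1 t $ 1 \<noteq> 0"
      by (simp add: \<gamma>_def u_def)
    ultimately show ?thesis
      by (metis zero_index)
  qed
  ultimately have "Cinf_arc (\<gamma> 0 ` {0..1})"
    unfolding Cinf_arc_def Ck_arc_def by (metis zero_less_one)
  then show ?thesis
    by (simp add: \<gamma>0)
qed

text \<open>
  The derivative is positive at some point strictly between any two points, and there the function
  really increases.
\<close>

lemma strict_mono_antiderivative:
  fixes f h :: "real \<Rightarrow> real"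
  assumes deriv: "\<And>x. a \<le> x \<Longrightarrow> x \<le> b \<Longrightarrow> (f has_real_derivative h x) (at x)"
    and nonneg: "\<And>x. 0 \<le> h x"
    and pos: "\<And>x y. x < y \<Longrightarrow> \<exists>t. x < t \<and> t < y \<and> 0 < h t"
    and xy: "a \<le> x" "x < y" "y \<le> b"
  shows "f x < f y"
proof -
  have mono: "f u \<le> f v" if "a \<le> u" "u \<le> v" "v \<le> b" for u v
    by (rule DERIV_nonneg_imp_nondecreasing[OF that(2)]) (use deriv nonneg that in \<open>meson order_trans\<close>)
  obtain t where t: "x < t" "t < y" "0 < h t"
    using pos xy by blast
  then obtain d where "0 < d" and d: "\<And>e. 0 < e \<Longrightarrow> e < d \<Longrightarrow> f t < f (t + e)"
    using DERIV_pos_inc_right[of f "h t" t] deriv[of t] xy by force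
  define e where "e = min (d / 2) (y - t)"
  have "0 < e" "e < d" "t + e \<le> y"
    using \<open>0 < d\<close> t by (auto simp: e_def)
  have "f x \<le> f t"
    using mono t xy by simp
  also have "\<dots> < f (t + e)"
    using d \<open>0 < e\<close> \<open>e < d\<close> by blast
  also have "\<dots> \<le> f y"
    using mono t xy \<open>0 < e\<close> \<open>t + e \<le> y\<close> by simp
  finally show ?thesis .
qed

lemma difference_quotient_small:
  fixes f :: "real \<Rightarrow> real"
  assumes "(f has_real_derivative 0) (at c)" "0 < s"
  shows "\<exists>e>0. \<forall>x. \<bar>x - c\<bar> < e \<longrightarrow> x \<noteq> c \<longrightarrow> (f x - f c) / (x - c) < s"
proof -
  have "(\<lambda>x. (f x - f c) / (x - c)) \<midarrow>c\<rightarrow> 0"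
    using assms(1) by (simp add: has_field_derivative_iff)
  then have "\<forall>\<^sub>F x in at c. (f x - f c) / (x - c) < s"
    using assms(2) by (rule order_tendstoD)
  then show ?thesis
    by (auto simp: eventually_at dist_real_def)
qed

text \<open>
  The points are chosen in the order \<open>c\<close>, \<open>a\<close>, \<open>d\<close>, \<open>b\<close>: each chord at \<open>c\<close> has a positive slope, and
  since the derivative at \<open>c\<close> is \<open>0\<close>, the next point can be put so near to \<open>c\<close> that its chord is
  less steep than the one before.
\<close>

lemma uncountable_flat_set_gives_triangle:
  fixes f :: "real \<Rightarrow> real"
  assumes "uncountable E" "0 < \<eta>"
    and mono: "\<And>x y. x \<in> E \<Longrightarrow> y \<in> E \<Longrightarrow> x < y \<Longrightarrow> f x < f y"
    and flat: "\<And>x. x \<in> E \<Longrightarrow> (f has_real_derivative 0) (at x)"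
  obtains a b c d where "a \<in> E" "b \<in> E" "c \<in> E" "d \<in> E" "a < b" "b < c" "c < d"
    "\<And>x. x \<in> {a, b, d} \<Longrightarrow> dist (pt x (f x)) (pt c (f c)) < \<eta>"
    "pt c (f c) \<in> interior (convex hull {pt a (f a), pt b (f b), pt d (f d)})"
proof -
  obtain c where c: "c \<in> E" and right: "\<And>e. 0 < e \<Longrightarrow> \<exists>x\<in>E. c < x \<and> x < c + e"
    and left: "\<And>e. 0 < e \<Longrightarrow> \<exists>x\<in>E. c - e < x \<and> x < c"
    using uncountable_two_sided_limit_point[OF \<open>uncountable E\<close>] by metis
  have "isCont f c"
    using flat[OF c] by (rule DERIV_isCont)
  then have "isCont (\<lambda>x. pt x (f x)) c"
    unfolding pt_def by (intro continuous_intros)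
  then obtain e where "0 < e" and e: "\<And>x. \<bar>x - c\<bar> < e \<Longrightarrow> dist (pt x (f x)) (pt c (f c)) < \<eta>"
    using \<open>0 < \<eta>\<close> unfolding continuous_at_eps_delta dist_real_def by blast
  obtain a where a: "a \<in> E" "c - e < a" "a < c"
    using left[OF \<open>0 < e\<close>] by blast
  have "0 < (f c - f a) / (c - a)"
    using mono[of a c] a c by simp
  then obtain e1 where "0 < e1"
    and e1: "\<And>x. \<bar>x - c\<bar> < e1 \<Longrightarrow> x \<noteq> c \<Longrightarrow> (f x - f c) / (x - c) < (f c - f a) / (c - a)"
    using difference_quotient_small[OF flat[OF c]] by blast
  obtain d where d: "d \<in> E" "c < d" "d < c + min e e1"
    using right[of "min e e1"] \<open>0 < e\<close> \<open>0 < e1\<close> by auto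
  have "0 < (f d - f c) / (d - c)"
    using mono[of c d] d c by simp
  then obtain e2 where "0 < e2"
    and e2: "\<And>x. \<bar>x - c\<bar> < e2 \<Longrightarrow> x \<noteq> c \<Longrightarrow> (f x - f c) / (x - c) < (f d - f c) / (d - c)"
    using difference_quotient_small[OF flat[OF c]] by blast
  obtain b where b: "b \<in> E" "c - min (c - a) e2 < b" "b < c"
    using left[of "min (c - a) e2"] \<open>0 < e2\<close> a by auto
  have "(f d - f c) / (d - c) < (f c - f a) / (c - a)"
    using e1[of d] d by simp
  moreover have "(f c - f b) / (c - b) < (f d - f c) / (d - c)"
    using e2[of b] b minus_divide_divide[of "f c - f b" "c - b"] by simp
  ultimately have "pt c (f c) \<in> interior (convex hull {pt a (f a), pt b (f b), pt d (f d)})"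
    using a b d by (intro graph_point_in_triangle) auto
  moreover have "a < b"
    using b by simp
  moreover have "dist (pt x (f x)) (pt c (f c)) < \<eta>" if "x \<in> {a, b, d}" for x
    using that a b d by (intro e) auto
  ultimately show ?thesis
    using that a(1) b(1,3) c d(1,2) by blast
qed

lemma perfect_graph_cantor_set:
  fixes f :: "real \<Rightarrow> real"
  assumes "continuous_on {0..1} f"
  shows "perfect ((\<lambda>t. pt t (f t)) ` cantor_set)"
proof -
  let ?g = "\<lambda>t. pt t (f t)"
  have sub: "cantor_set \<subseteq> {0..1}"
    by (auto simp: cantor_set_def)
  have cont: "continuous_on cantor_set ?g"
    unfolding pt_def by (intro continuous_intros continuous_on_subset[OF assms sub])
  have "compact cantor_set"
    using closed_cantor_set sub by (meson bounded_closed_interval bounded_subset compact_eq_bounded_closed)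
  then have "closed (?g ` cantor_set)"
    using cont by (intro compact_imp_closed compact_continuous_image)
  moreover have "\<not> ?g x isolated_in ?g ` cantor_set" if x: "x \<in> cantor_set" for x
  proof
    assume "?g x isolated_in ?g ` cantor_set"
    then obtain T where T: "open T" "T \<inter> ?g ` cantor_set = {?g x}"
      unfolding isolated_in_def by blast
    have "?g x \<in> T"
      using T(2) by blast
    then obtain \<epsilon> where "0 < \<epsilon>" and \<epsilon>: "ball (?g x) \<epsilon> \<subseteq> T"
      using T(1) openE by blast
    obtain \<delta> where "0 < \<delta>" and \<delta>: "\<And>y. y \<in> cantor_set \<Longrightarrow> dist y x < \<delta> \<Longrightarrow> dist (?g y) (?g x) < \<epsilon>"
      using cont x \<open>0 < \<epsilon>\<close> unfolding continuous_on_iff by metis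
    obtain y where "y \<in> cantor_set" "y \<noteq> x" "\<bar>y - x\<bar> < \<delta>"
      using cantor_set_not_isolated[OF x \<open>0 < \<delta>\<close>] by blast
    then have "?g y \<in> T \<inter> ?g ` cantor_set"
      using \<delta>[of y] \<epsilon> by (auto simp: dist_real_def dist_commute)
    then show False
      using T(2) \<open>y \<noteq> x\<close> by auto
  qed
  ultimately show ?thesis
    using zero_in_cantor_set unfolding perfect_def by blast
qed

theorem theorem1p6:
  shows "\<exists>P :: plane set. perfect P \<and> (\<exists>B. Cinf_arc B \<and> P \<subseteq> B) \<and>
           (\<forall>A. non_squiggly A \<longrightarrow> countable (P \<inter> A))"
proof -
  obtain r where r: "r 0 = cantor_height" "\<And>k x. (r k has_real_derivative r (Suc k) x) (at x)"
    using cantor_height_derivatives by blast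
  \<comment> \<open>A larger interval than \<open>[0, 1]\<close> makes the derivative of \<open>f\<close> two-sided on all of \<open>[0, 1]\<close>.\<close>
  have "continuous_on {-1..2} cantor_height"
    using r by (metis DERIV_continuous_on has_field_derivative_at_within)
  then obtain f where f':
    "\<And>x. x \<in> {-1..2} \<Longrightarrow> (f has_vector_derivative cantor_height x) (at x within {-1..2})"
    using antiderivative_continuous by metis
  have f: "(f has_real_derivative cantor_height x) (at x)" if "0 \<le> x" "x \<le> 1" for x
  proof -
    have "at x within {-1..2} = at x"
      by (rule at_within_interior) (use that in simp)
    then show ?thesis
      using f'[of x] that by (simp add: has_real_derivative_iff_has_vector_derivative)
  qed
  let ?g = "\<lambda>t. pt t (f t)"
  have sub: "cantor_set \<subseteq> {0..1}"
    by (auto simp: cantor_set_def)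
  define F where "F k = (case k of 0 \<Rightarrow> f | Suc k \<Rightarrow> r k)" for k
  have "(F k has_real_derivative F (Suc k) t) (at t within {0..1})" if "t \<in> {0..1}" for k t
    using f r that by (cases k) (auto simp: F_def intro: has_field_derivative_at_within)
  from Cinf_arc_graph[of F, OF this] have "Cinf_arc (?g ` {0..1})"
    by (simp add: F_def)
  moreover have "?g ` cantor_set \<subseteq> ?g ` {0..1}"
    using sub by blast
  moreover have "perfect (?g ` cantor_set)"
    by (rule perfect_graph_cantor_set, rule DERIV_continuous_on, rule has_field_derivative_at_within, rule f)
      auto
  moreover have "countable (?g ` cantor_set \<inter> A)" if "non_squiggly A" for A
  proof (rule ccontr)
    assume uncountable: "uncountable (?g ` cantor_set \<inter> A)"
    define E where "E = {t \<in> cantor_set. ?g t \<in> A}"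
    have "?g ` cantor_set \<inter> A = ?g ` E"
      by (auto simp: E_def)
    then have "uncountable E"
      using uncountable by auto
    have E: "0 \<le> x" "x \<le> 1" "cantor_height x = 0" "?g x \<in> A" if "x \<in> E" for x
      using that by (auto simp: E_def cantor_set_def cantor_height_eq_0_iff)
    obtain \<delta> :: ereal where "0 < \<delta>" and \<delta>: "\<And>x y z t. x \<in> A \<Longrightarrow> y \<in> A \<Longrightarrow> z \<in> A \<Longrightarrow> t \<in> A \<Longrightarrow>
        distinct [x, y, z, t] \<Longrightarrow> ereal (diameter {x, y, z, t}) \<le> \<delta> \<Longrightarrow>
        t \<notin> interior (convex hull {x, y, z})"
      using \<open>non_squiggly A\<close> unfolding non_squiggly_def by metis
    obtain \<eta> where "0 < \<eta>" "ereal (2 * \<eta>) \<le> \<delta>"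
    proof (cases \<delta>)
      case (real s)
      then show ?thesis
        using \<open>0 < \<delta>\<close> by (intro that[of "s / 2"]) auto
    qed (use \<open>0 < \<delta>\<close> that[of 1] in auto)
    have "(f has_real_derivative 0) (at x)" if "x \<in> E" for x
      using f[of x] E[OF that] by simp
    moreover have "f x < f y" if "x \<in> E" "y \<in> E" "x < y" for x y
      by (rule strict_mono_antiderivative[of 0 1 f cantor_height])
        (use f E that cantor_height_nonneg cantor_height_pos_between in auto)
    ultimately obtain a b c d where abcd: "a \<in> E" "b \<in> E" "c \<in> E" "d \<in> E" "a < b" "b < c" "c < d"
      and near: "\<And>x. x \<in> {a, b, d} \<Longrightarrow> dist (?g x) (?g c) < \<eta>"
      and interior: "?g c \<in> interior (convex hull {?g a, ?g b, ?g d})"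
      using uncountable_flat_set_gives_triangle[OF \<open>uncountable E\<close> \<open>0 < \<eta>\<close>, of f] by blast
    have "diameter {?g a, ?g b, ?g d, ?g c} \<le> 2 * \<eta>"
    proof (rule diameter_le)
      fix v w
      assume "v \<in> {?g a, ?g b, ?g d, ?g c}" "w \<in> {?g a, ?g b, ?g d, ?g c}"
      then have "dist v (?g c) < \<eta>" "dist w (?g c) < \<eta>"
        using near \<open>0 < \<eta>\<close> by auto
      then show "norm (v - w) \<le> 2 * \<eta>"
        using dist_triangle2[of v w "?g c"] by (simp add: dist_norm)
    qed simp
    then have "ereal (diameter {?g a, ?g b, ?g d, ?g c}) \<le> \<delta>"
      using \<open>ereal (2 * \<eta>) \<le> \<delta>\<close> by (meson ereal_less_eq(3) order_trans)
    moreover have "distinct [?g a, ?g b, ?g d, ?g c]"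
      using abcd by simp
    ultimately show False
      using \<delta>[of "?g a" "?g b" "?g d" "?g c"] E(4) abcd interior by blast
  qed
  ultimately show ?thesis
    by blast
qed

end
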